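(* Consider an integrated shift and task scheduling problem (ISTSP) whose objective is to minimize the number of workers and one of whose constraints is that each worker is assigned at most $b$ shift schedules in the planning horizon, i.e. $\sum_{v=1}^{\tau}z_{uv}\le b$ for $u=1,\ldots,w$. Let $B$ be any lower bound for the stage 1 objective function, the number of shift schedules assigned; that is, $\sum_{i=1}^{q}\sum_{j=1}^{T}x_{ij}\ge B$ for every $(X,Y)$ satisfying the stage 1 constraints. Then $\left\lceil \frac{B}{b}\right\rceil$ is a lower bound for the number of workers, i.e. every feasible solution of the ISTSP uses at least $\left\lceil \frac{B}{b}\right\rceil$ workers.
   Context: **Data.** The planning horizon is $\mathcal{T}=[1,2,\ldots,T]$ ($T$ time periods, TPs), treated cyclically: the wrap function $\theta$ maps every integer to the element of $\{1,\ldots,T\}$ congruent to it modulo $T$ (so $\theta(0)=T$, $\theta(-1)=T-1$, $\theta(T+1)=1$, etc.). There are $K$ tasks. Task $k$ has a start window $[l_k,u_k]$ with $l_k,u_k\in\mathcal{T}$, $l_k\le u_k$; a duration $d_k$ (a positive integer number of TPs); and a resource vector $\mathbf{r}_k=(r_{k1},\ldots,r_{kd_k})$ of nonnegative integers, $r_{kj}$ being the number of workers required in the $j$-th TP of task $k$. A set $\mathcal{P}$ of pairs of tasks is given; $(k,k')\in\mathcal{P}$ means that task $k$ must be completed before task $k'$ starts. A finite set $\mathcal{S}=\{\mathbf{s}^1,\ldots,\mathbf{s}^q\}$ of shift patterns is given; $\mathbf{s}^i=(s^i_1,\ldots,s^i_{m_i})$ is a binary vector of length $m_i$, with $s^i_t$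 indicating whether a worker is available in the $t$-th TP of the shift. A shift schedule $(\mathbf{s}^i,j)$ means that a worker starts a shift at TP $j\in\mathcal{T}$ and works according to pattern $\mathbf{s}^i$. The bound $b$ is a positive integer. **Stage 1 constraints.** The variables are $y_{kj}\in\{0,1\}$ ($y_{kj}=1$ iff task $k$ starts in TP $j$) and nonnegative integers $x_{ij}$ (the number of shift schedules $(\mathbf{s}^i,j)$ used), for $1\le k\le K$, $1\le i\le q$, $j\in\mathcal{T}$; $X=(x_{ij})$, $Y=(y_{kj})$. The constraints are: - supply meets demand: $\sum_{i=1}^{q}\sum_{t=1}^{m_i}s^i_t\,x_{i\theta(j-t+1)}\ \ge\ \sum_{k=1}^{K}\sum_{i=1}^{d_k}r_{ki}\,y_{k\theta(j-i+1)}$ for $j=1,\ldots,T$; - precedence: $\sum_{j=1}^{T}(j+d_k-1)y_{kj}\le\sum_{j=1}^{T}j\,y_{k'j}$ for all $(k,k')\in\mathcal{P}$; - each task starts exactly once: $\sum_{j=1}^{T}y_{kj}=1$ for all $k$; - start windows: $\sum_{j=1}^{l_k-1}y_{kj}+\sum_{j=u_k+1}^{T}y_{kj}=0$ for all $k$. The stage 1 objective function here is the number of shift schedules assigned, $\sum_{i,j}x_{ij}$. **Stage 2 constraints.** Given $X$, list all shift schedules $(\mathbf{s}^i,j)$ with $x_{ij}>0$, each repeated $x_{ij}$ times, in ascending order of start TP: $\mathcal{U}_v=(\mathbf{s}^{i_v},j_v)$, $v=1,\ldots,\tau$, where $\tau=\sum_{i,j}x_{ij}$ and $j_1\le\cdots\le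 j_\tau$. Workers are labelled $1,\ldots,w$, where $w$ is the maximum number of workers available. The variables are $z_{uv}\in\{0,1\}$, with $z_{uv}=1$ iff worker $u$ is assigned $\mathcal{U}_v$; $Z=(z_{uv})$. The constraints are the assignment constraint $\sum_{u=1}^{w}z_{uv}=1$ for $v=1,\ldots,\tau$, the constraint $\sum_{v=1}^{\tau}z_{uv}\le b$ for $u=1,\ldots,w$, and possibly other staff scheduling constraints on $Z$ (such as minimum rest periods between shifts of the same worker, maximum total hours per worker, days off). **ISTSP.** A feasible solution of the ISTSP is a triple $(X,Y,Z)$ such that $(X,Y)$ satisfies the stage 1 constraints and $Z$ satisfies the stage 2 constraints for the list of shift schedules built from $X$. The number of workers of a feasible solution is the number of workers $u$ who are assigned at least one shift schedule, i.e. with $z_{uv}=1$ for some $v\in\{1,\ldots,\tau\}$. *)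

theory Defs
  imports Complex_Main "HOL-Number_Theory.Cong"
begin

text \<open>
  Tasks, shift patterns, time periods, workers and list positions are all numbered from 1, and
  families indexed by them are functions on the naturals of which only the values inside the index
  range are meaningful.
\<close>

record istsp =
  horizon :: nat                                    \<comment> \<open>\<open>T\<close>\<close>
  num_tasks :: nat                                  \<comment> \<open>\<open>K\<close>\<close>
  win_lo :: "nat \<Rightarrow> nat"                            \<comment> \<open>\<open>l\<^sub>k\<close>\<close>
  win_hi :: "nat \<Rightarrow> nat"                            \<comment> \<open>\<open>u\<^sub>k\<close>\<close>
  duration :: "nat \<Rightarrow> nat"                          \<comment> \<open>\<open>d\<^sub>k\<close>\<close>
  resource :: "nat \<Rightarrow> nat \<Rightarrow> nat"                   \<comment> \<open>\<open>r\<^sub>k\<^sub>j\<close>\<close>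
  precedence :: "(nat \<times> nat) set"                   \<comment> \<open>\<open>P\<close>\<close>
  num_patterns :: nat                               \<comment> \<open>\<open>q\<close>\<close>
  pattern_len :: "nat \<Rightarrow> nat"                       \<comment> \<open>\<open>m\<^sub>i\<close>\<close>
  shift_pattern :: "nat \<Rightarrow> nat \<Rightarrow> nat"              \<comment> \<open>\<open>s\<^sup>i\<^sub>t\<close> is \<open>shift_pattern I i t\<close>\<close>
  max_workers :: nat                                \<comment> \<open>\<open>w\<close>\<close>
  shift_bound :: nat                                \<comment> \<open>\<open>b\<close>\<close>
  other_constraints :: "(nat \<times> nat) list \<Rightarrow> (nat \<Rightarrow> nat \<Rightarrow> nat) \<Rightarrow> bool"
    \<comment> \<open>the additional staff scheduling constraints: an arbitrary condition on \<open>Z\<close>, which may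
        refer to the list of shift schedules (pairs of pattern index and start period)\<close>

definition valid_istsp :: "istsp \<Rightarrow> bool" where
  "valid_istsp I \<longleftrightarrow>
     horizon I \<ge> 1 \<and>
     (\<forall>k\<in>{1..num_tasks I}.
        win_lo I k \<in> {1..horizon I} \<and> win_hi I k \<in> {1..horizon I} \<and>
        win_lo I k \<le> win_hi I k \<and> duration I k \<ge> 1) \<and>
     precedence I \<subseteq> {1..num_tasks I} \<times> {1..num_tasks I} \<and>
     (\<forall>i\<in>{1..num_patterns I}. \<forall>t\<in>{1..pattern_len I i}. shift_pattern I i t \<in> {0, 1}) \<and>
     \<comment> \<open>the patterns form a set, so the vectors \<open>s\<^sup>1, \<dots>, s\<^sup>q\<close> are distinct\<close>
     inj_on (\<lambda>i. map (shift_pattern I i) [1..<Suc (pattern_len I i)]) {1..num_patterns I} \<and>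
     shift_bound I \<ge> 1"

definition wrap :: "nat \<Rightarrow> int \<Rightarrow> nat" where
  "wrap T n = nat ((n - 1) mod int T) + 1"

lemma wrap_in_range: "T \<ge> 1 \<Longrightarrow> wrap T n \<in> {1..T}"
  unfolding wrap_def by (simp add: Suc_le_eq nat_less_iff)

lemma wrap_cong: "T \<ge> 1 \<Longrightarrow> [int (wrap T n) = n] (mod int T)"
  unfolding wrap_def cong_def by (simp add: mod_simps)

definition stage1_feasible :: "istsp \<Rightarrow> (nat \<Rightarrow> nat \<Rightarrow> nat) \<Rightarrow> (nat \<Rightarrow> nat \<Rightarrow> nat) \<Rightarrow> bool" where
  "stage1_feasible I X Y \<longleftrightarrow>
     (\<forall>k\<in>{1..num_tasks I}. \<forall>j\<in>{1..horizon I}. Y k j \<in> {0, 1}) \<and>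
     (\<forall>j\<in>{1..horizon I}.
        (\<Sum>i=1..num_patterns I. \<Sum>t=1..pattern_len I i.
            shift_pattern I i t * X i (wrap (horizon I) (int j - int t + 1)))
        \<ge> (\<Sum>k=1..num_tasks I. \<Sum>i=1..duration I k.
            resource I k i * Y k (wrap (horizon I) (int j - int i + 1)))) \<and>
     (\<forall>(k, k')\<in>precedence I.
        (\<Sum>j=1..horizon I. (j + duration I k - 1) * Y k j) \<le> (\<Sum>j=1..horizon I. j * Y k' j)) \<and>
     (\<forall>k\<in>{1..num_tasks I}. (\<Sum>j=1..horizon I. Y k j) = 1) \<and>
     (\<forall>k\<in>{1..num_tasks I}.
        (\<Sum>j=1..win_lo I k - 1. Y k j) + (\<Sum>j=win_hi I k + 1..horizon I. Y k j) = 0)"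

text \<open>The stage 1 objective, which is also the length \<open>\<tau>\<close> of the list of shift schedules.\<close>

definition num_schedules :: "istsp \<Rightarrow> (nat \<Rightarrow> nat \<Rightarrow> nat) \<Rightarrow> nat" where
  "num_schedules I X = (\<Sum>i=1..num_patterns I. \<Sum>j=1..horizon I. X i j)"

text \<open>
  The order of schedules with equal start period is left open. The \<open>v\<close>-th schedule of the list
  is \<open>U ! (v - 1)\<close>.
\<close>

definition schedule_list :: "istsp \<Rightarrow> (nat \<Rightarrow> nat \<Rightarrow> nat) \<Rightarrow> (nat \<times> nat) list \<Rightarrow> bool" where
  "schedule_list I X U \<longleftrightarrow>
     set U \<subseteq> {1..num_patterns I} \<times> {1..horizon I} \<and>
     (\<forall>i\<in>{1..num_patterns I}. \<forall>j\<in>{1..horizon I}. count_list U (i, j) = X i j) \<and>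
     sorted (map snd U)"

definition stage2_feasible ::
  "istsp \<Rightarrow> (nat \<Rightarrow> nat \<Rightarrow> nat) \<Rightarrow> (nat \<times> nat) list \<Rightarrow> (nat \<Rightarrow> nat \<Rightarrow> nat) \<Rightarrow> bool" where
  "stage2_feasible I X U Z \<longleftrightarrow>
     (\<forall>u\<in>{1..max_workers I}. \<forall>v\<in>{1..num_schedules I X}. Z u v \<in> {0, 1}) \<and>
     (\<forall>v\<in>{1..num_schedules I X}. (\<Sum>u=1..max_workers I. Z u v) = 1) \<and>
     (\<forall>u\<in>{1..max_workers I}. (\<Sum>v=1..num_schedules I X. Z u v) \<le> shift_bound I) \<and>
     other_constraints I U Z"

definition istsp_feasible ::
  "istsp \<Rightarrow> (nat \<Rightarrow> nat \<Rightarrow> nat) \<Rightarrow> (nat \<Rightarrow> nat \<Rightarrow> nat) \<Rightarrow> (nat \<Rightarrow> nat \<Rightarrow> nat) \<Rightarrow> bool" where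
  "istsp_feasible I X Y Z \<longleftrightarrow>
     stage1_feasible I X Y \<and> (\<exists>U. schedule_list I X U \<and> stage2_feasible I X U Z)"

definition num_workers :: "istsp \<Rightarrow> (nat \<Rightarrow> nat \<Rightarrow> nat) \<Rightarrow> (nat \<Rightarrow> nat \<Rightarrow> nat) \<Rightarrow> nat" where
  "num_workers I X Z =
     card {u \<in> {1..max_workers I}. \<exists>v\<in>{1..num_schedules I X}. Z u v = 1}"

end

theory Submission
  imports Defs
begin

text \<open>
  The argument is double counting. Every schedule of the list is assigned to exactly one worker,
  so the number of schedules \<open>\<tau>\<close> is the sum of all entries of \<open>Z\<close>. Summed by rows instead, an idle
  worker contributes nothing and any other worker at most \<open>b\<close>, so \<open>\<tau>\<close> is at most \<open>b\<close> times the number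
  of workers used. Since \<open>B \<le> \<tau>\<close>, at least \<open>B / b\<close> workers are used, and integrality of their
  number permits rounding up.
\<close>

lemma card_columns_le_bound_times_active_rows:
  fixes Z :: "'a \<Rightarrow> 'b \<Rightarrow> nat"
  assumes "finite R"
    and binary: "\<And>u v. u \<in> R \<Longrightarrow> v \<in> C \<Longrightarrow> Z u v \<in> {0, 1}"
    and column: "\<And>v. v \<in> C \<Longrightarrow> (\<Sum>u\<in>R. Z u v) = 1"
    and row: "\<And>u. u \<in> R \<Longrightarrow> (\<Sum>v\<in>C. Z u v) \<le> b"
  shows "card C \<le> b * card {u \<in> R. \<exists>v\<in>C. Z u v = 1}"
proof -
  let ?A = "{u \<in> R. \<exists>v\<in>C. Z u v = 1}"
  have "card C = (\<Sum>v\<in>C. \<Sum>u\<in>R. Z u v)"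
    using column by simp
  also have "\<dots> = (\<Sum>u\<in>R. \<Sum>v\<in>C. Z u v)"
    by (rule sum.swap)
  also have "\<dots> = (\<Sum>u\<in>?A. \<Sum>v\<in>C. Z u v)"
  proof (rule sum.mono_neutral_right)
    show "\<forall>u\<in>R - ?A. (\<Sum>v\<in>C. Z u v) = 0"
      using binary by (intro ballI sum.neutral) blast
  qed (use \<open>finite R\<close> in auto)
  also have "\<dots> \<le> card ?A * b"
    using sum_bounded_above[of ?A "\<lambda>u. \<Sum>v\<in>C. Z u v" b] row by simp
  finally show ?thesis
    by (simp add: mult.commute)
qed

theorem theorem3p2:
  fixes I :: istsp and B :: real
  assumes "valid_istsp I"
    and "\<forall>X Y. stage1_feasible I X Y \<longrightarrow> real (num_schedules I X) \<ge> B"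
  shows "\<forall>X Y Z. istsp_feasible I X Y Z \<longrightarrow>
           int (num_workers I X Z) \<ge> \<lceil>B / real (shift_bound I)\<rceil>"
proof (intro allI impI)
  fix X Y Z
  assume feasible: "istsp_feasible I X Y Z"
  then obtain U where stage2: "stage2_feasible I X U Z"
    by (auto simp: istsp_feasible_def)
  have "card {1..num_schedules I X} \<le> shift_bound I * num_workers I X Z"
    unfolding num_workers_def
    using stage2 by (intro card_columns_le_bound_times_active_rows) (auto simp: stage2_feasible_def)
  then have "real (num_schedules I X) \<le> real (shift_bound I) * real (num_workers I X Z)"
    by (simp flip: of_nat_mult)
  moreover have "B \<le> real (num_schedules I X)"
    using assms(2) feasible by (auto simp: istsp_feasible_def)
  moreover have "real (shift_bound I) > 0"
    using assms(1) by (simp add: valid_istsp_def)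
  ultimately have "B / real (shift_bound I) \<le> real (num_workers I X Z)"
    by (simp add: pos_divide_le_eq mult.commute)
  then show "int (num_workers I X Z) \<ge> \<lceil>B / real (shift_bound I)\<rceil>"
    by (simp add: ceiling_le_iff)
qed

end
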